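(* Let $p$ be a prime with $p\equiv 1 \pmod 3$, $\mathcal{R}=\mathbb{F}_p+u\mathbb{F}_p+u^2\mathbb{F}_p+u^3\mathbb{F}_p$ with $u^4=u$, and let $\eta_1,\eta_2,\eta_3,\eta_4$ be the idempotents defined below. Let $\mathcal{C}=\eta_1\mathcal{C}_1\oplus\eta_2\mathcal{C}_2\oplus\eta_3\mathcal{C}_3\oplus\eta_4\mathcal{C}_4$ be a linear code of length $n$ over $\mathcal{R}$, where $\mathcal{C}_1,\dots,\mathcal{C}_4$ are its component codes over $\mathbb{F}_p$. Then $\mathcal{C}$ is a $(1-2u^3)$-constacyclic code if and only if $\mathcal{C}_1$ is a cyclic code and $\mathcal{C}_2,\mathcal{C}_3,\mathcal{C}_4$ are negacyclic codes of length $n$ over $\mathbb{F}_p$. Further, $\mathcal{C}$ is $(1-2u^3)$-constacyclic if and only if $\mathcal{C}^\perp$ is $(1-2u^3)$-constacyclic.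
   Context: Let $\xi\in\mathbb{F}_p$ be a primitive cube root of unity ($\xi^3=1\neq\xi$, so $\xi^2+\xi+1=0$). Set $\eta_1=1-u^3$, $\eta_2=3^{-1}(u+u^2+u^3)$, $\eta_3=3^{-1}(\xi u+\xi^2u^2+u^3)$, $\eta_4=3^{-1}(\xi^2u+\xi u^2+u^3)$; these are pairwise orthogonal idempotents with $\sum\eta_i=1$. For a linear code $\mathcal{C}$ ($\mathcal{R}$-submodule of $\mathcal{R}^n$), $\mathcal{C}_1=\{x\in\mathbb{F}_p^n:\exists\,y,z,t\in\mathbb{F}_p^n,\ \eta_1x+\eta_2y+\eta_3z+\eta_4t\in\mathcal{C}\}$, and $\mathcal{C}_2,\mathcal{C}_3,\mathcal{C}_4$ are defined analogously as the sets of possible second, third, fourth components; then $\mathcal{C}=\bigoplus_i\eta_i\mathcal{C}_i$. A code is $\lambda$-constacyclic if invariant under $(r_0,\dots,r_{n-1})\mapsto(\lambda r_{n-1},r_0,\dots,r_{n-2})$; cyclic means $\lambda=1$, negacyclic means $\lambda=-1$. $\mathcal{C}^\perp$ is the dual with respect to the Euclidean inner product. *)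

theory Defs
  imports
    "Berlekamp_Zassenhaus.Finite_Field"
    "Jordan_Normal_Form.Matrix"
    "HOL-Number_Theory.Cong"
begin

text \<open>
  The ring \<open>R = F + uF + u\<^sup>2F + u\<^sup>3F\<close> with \<open>u\<^sup>4 = u\<close>: the value \<open>RU a b c d\<close> stands for
  \<open>a + b u + c u\<^sup>2 + d u\<^sup>3\<close>.  In a product, \<open>u\<^sup>4\<close>, \<open>u\<^sup>5\<close> and \<open>u\<^sup>6\<close> reduce to
  \<open>u\<close>, \<open>u\<^sup>2\<close> and \<open>u\<^sup>3\<close>.
\<close>

datatype 'a ru = RU (cf0: 'a) (cf1: 'a) (cf2: 'a) (cf3: 'a)

instantiation ru :: (comm_ring_1) comm_ring_1
begin

definition zero_ru :: "'a ru" where "0 = RU 0 0 0 0"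

definition one_ru :: "'a ru" where "1 = RU 1 0 0 0"

definition plus_ru :: "'a ru \<Rightarrow> 'a ru \<Rightarrow> 'a ru" where
  "r + s = RU (cf0 r + cf0 s) (cf1 r + cf1 s) (cf2 r + cf2 s) (cf3 r + cf3 s)"

definition uminus_ru :: "'a ru \<Rightarrow> 'a ru" where
  "- r = RU (- cf0 r) (- cf1 r) (- cf2 r) (- cf3 r)"

definition minus_ru :: "'a ru \<Rightarrow> 'a ru \<Rightarrow> 'a ru" where
  "r - s = RU (cf0 r - cf0 s) (cf1 r - cf1 s) (cf2 r - cf2 s) (cf3 r - cf3 s)"

definition times_ru :: "'a ru \<Rightarrow> 'a ru \<Rightarrow> 'a ru" where
  "r * s = RU
    (cf0 r * cf0 s)
    (cf0 r * cf1 s + cf1 r * cf0 s + (cf1 r * cf3 s + cf2 r * cf2 s + cf3 r * cf1 s))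
    (cf0 r * cf2 s + cf1 r * cf1 s + cf2 r * cf0 s + (cf2 r * cf3 s + cf3 r * cf2 s))
    (cf0 r * cf3 s + cf1 r * cf2 s + cf2 r * cf1 s + cf3 r * cf0 s + cf3 r * cf3 s)"

instance
  by standard
    (simp_all add: ru.expand zero_ru_def one_ru_def plus_ru_def uminus_ru_def minus_ru_def
      times_ru_def algebra_simps)

end

definition const_ru :: "'a::comm_ring_1 \<Rightarrow> 'a ru" where
  "const_ru a = RU a 0 0 0"

definition u :: "'a::comm_ring_1 ru" where
  "u = RU 0 1 0 0"

lemmas ru_arith = zero_ru_def one_ru_def plus_ru_def uminus_ru_def minus_ru_def times_ru_def
  const_ru_def u_def

lemma u_pow_2: "(u :: 'a::comm_ring_1 ru) ^ 2 = RU 0 0 1 0"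
  and u_pow_3: "(u :: 'a::comm_ring_1 ru) ^ 3 = RU 0 0 0 1"
  by (simp_all add: ru_arith power2_eq_square power3_eq_cube)

lemma u_pow_4: "(u :: 'a::comm_ring_1 ru) ^ 4 = u"
  by (simp add: ru_arith power4_eq_xxxx)

lemma ru_basis:
  "RU a b c d = const_ru a + const_ru b * u + const_ru c * u ^ 2 + const_ru d * u ^ 3"
  unfolding u_pow_2 u_pow_3 by (simp add: ru_arith)


text \<open>
  For \<open>\<xi>\<close> a primitive cube root of unity these are pairwise orthogonal idempotents with sum 1.
\<close>

definition eta1 :: "'a::field ru" where
  "eta1 = 1 - u ^ 3"

definition eta2 :: "'a::field ru" where
  "eta2 = const_ru (inverse 3) * (u + u ^ 2 + u ^ 3)"

definition eta3 :: "'a::field \<Rightarrow> 'a ru" where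
  "eta3 \<xi> = const_ru (inverse 3) * (const_ru \<xi> * u + const_ru (\<xi> ^ 2) * u ^ 2 + u ^ 3)"

definition eta4 :: "'a::field \<Rightarrow> 'a ru" where
  "eta4 \<xi> = const_ru (inverse 3) * (const_ru (\<xi> ^ 2) * u + const_ru \<xi> * u ^ 2 + u ^ 3)"


definition linear_code :: "nat \<Rightarrow> 'a::comm_ring_1 vec set \<Rightarrow> bool" where
  "linear_code n C \<longleftrightarrow>
    C \<subseteq> carrier_vec n \<and> 0\<^sub>v n \<in> C \<and>
    (\<forall>x\<in>C. \<forall>y\<in>C. x + y \<in> C) \<and>
    (\<forall>a. \<forall>x\<in>C. a \<cdot>\<^sub>v x \<in> C)"

definition constashift :: "'a::comm_ring_1 \<Rightarrow> 'a vec \<Rightarrow> 'a vec" where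
  "constashift l r =
    vec (dim_vec r) (\<lambda>i. if i = 0 then l * r $ (dim_vec r - 1) else r $ (i - 1))"

definition constacyclic :: "nat \<Rightarrow> 'a::comm_ring_1 \<Rightarrow> 'a vec set \<Rightarrow> bool" where
  "constacyclic n l C \<longleftrightarrow> C \<subseteq> carrier_vec n \<and> (\<forall>r\<in>C. constashift l r \<in> C)"

abbreviation cyclic :: "nat \<Rightarrow> 'a::comm_ring_1 vec set \<Rightarrow> bool" where
  "cyclic n C \<equiv> constacyclic n 1 C"

abbreviation negacyclic :: "nat \<Rightarrow> 'a::comm_ring_1 vec set \<Rightarrow> bool" where
  "negacyclic n C \<equiv> constacyclic n (- 1) C"

definition dual_code :: "nat \<Rightarrow> 'a::comm_ring_1 vec set \<Rightarrow> 'a vec set" where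
  "dual_code n C = {x \<in> carrier_vec n. \<forall>c\<in>C. x \<bullet> c = 0}"


definition eta_comb :: "'a::field \<Rightarrow> 'a vec \<Rightarrow> 'a vec \<Rightarrow> 'a vec \<Rightarrow> 'a vec \<Rightarrow> 'a ru vec" where
  "eta_comb \<xi> x y z t =
    eta1 \<cdot>\<^sub>v map_vec const_ru x + eta2 \<cdot>\<^sub>v map_vec const_ru y +
    eta3 \<xi> \<cdot>\<^sub>v map_vec const_ru z + eta4 \<xi> \<cdot>\<^sub>v map_vec const_ru t"

definition comp1 :: "nat \<Rightarrow> 'a::field \<Rightarrow> 'a ru vec set \<Rightarrow> 'a vec set" where
  "comp1 n \<xi> C = {x \<in> carrier_vec n.
    \<exists>y\<in>carrier_vec n. \<exists>z\<in>carrier_vec n. \<exists>t\<in>carrier_vec n. eta_comb \<xi> x y z t \<in> C}"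

definition comp2 :: "nat \<Rightarrow> 'a::field \<Rightarrow> 'a ru vec set \<Rightarrow> 'a vec set" where
  "comp2 n \<xi> C = {y \<in> carrier_vec n.
    \<exists>x\<in>carrier_vec n. \<exists>z\<in>carrier_vec n. \<exists>t\<in>carrier_vec n. eta_comb \<xi> x y z t \<in> C}"

definition comp3 :: "nat \<Rightarrow> 'a::field \<Rightarrow> 'a ru vec set \<Rightarrow> 'a vec set" where
  "comp3 n \<xi> C = {z \<in> carrier_vec n.
    \<exists>x\<in>carrier_vec n. \<exists>y\<in>carrier_vec n. \<exists>t\<in>carrier_vec n. eta_comb \<xi> x y z t \<in> C}"

definition comp4 :: "nat \<Rightarrow> 'a::field \<Rightarrow> 'a ru vec set \<Rightarrow> 'a vec set" where
  "comp4 n \<xi> C = {t \<in> carrier_vec n.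
    \<exists>x\<in>carrier_vec n. \<exists>y\<in>carrier_vec n. \<exists>z\<in>carrier_vec n. eta_comb \<xi> x y z t \<in> C}"

end

theory Submission
  imports Defs "HOL-Library.Function_Algebras"
begin

text \<open>
  Evaluation at the four roots \<open>0, 1, \<xi>\<^sup>2, \<xi>\<close> of \<open>X\<^sup>4 - X\<close> gives ring homomorphisms from
  \<open>R\<close> to the field; \<open>\<eta>\<^sub>1, \<dots>, \<eta>\<^sub>4\<close> are the Lagrange idempotents at these roots, so the
  component codes are the images of \<open>C\<close> under the evaluations and determine \<open>C\<close>.  Evaluation
  carries the \<open>l\<close>-constacyclic shift to the shift by the value of \<open>l\<close>, and \<open>1 - 2u\<^sup>3\<close> takes
  the values \<open>1, -1, -1, -1\<close>.

  If \<open>l\<^sup>2 = 1\<close>, the shift is an isometry whose \<open>n\<close>-th power is multiplication by \<open>l\<close>; hence it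
  maps an invariant code onto itself and preserves its dual.  The converse follows because
  \<open>C\<close> is its own double dual, which reduces by evaluation to the case of a field.
\<close>

section \<open>Constacyclic shifts and dual codes over a commutative ring\<close>

lemma constashift_carrier [simp]: "r \<in> carrier_vec n \<Longrightarrow> constashift l r \<in> carrier_vec n"
  by (auto simp: constashift_def)

text \<open>The wrapped entries contribute the factor \<open>l * l\<close>, which is 1; the other
  products only change place.\<close>

lemma scalar_prod_constashift:
  fixes x y :: "'a::comm_ring_1 vec"
  assumes "x \<in> carrier_vec n" "y \<in> carrier_vec n" "l * l = 1"
  shows "constashift l x \<bullet> constashift l y = x \<bullet> y"
proof (cases n)
  case 0
  then show ?thesis using assms by (simp add: scalar_prod_def constashift_def)
next
  case (Suc m)
  have l: "l * a * (l * b) = a * b" for a b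
    using assms(3) by (metis mult.assoc mult.commute mult.left_neutral)
  have "constashift l x \<bullet> constashift l y
      = (\<Sum>i<Suc m. constashift l x $ i * constashift l y $ i)"
    using assms Suc by (simp add: scalar_prod_def constashift_def atLeast0LessThan)
  \<comment> \<open>Index 0, where the wrapped entries sit, is split off; the other indices move
    down by one.\<close>
  also have "\<dots> = x $ m * y $ m + (\<Sum>i<m. x $ i * y $ i)"
    using assms Suc unfolding sum.lessThan_Suc_shift by (simp add: constashift_def l)
  also have "\<dots> = x \<bullet> y"
    using assms Suc by (simp add: scalar_prod_def atLeast0LessThan add.commute)
  finally show ?thesis .
qed

text \<open>For \<open>k \<le> n\<close> each entry wraps at most once, so \<open>l\<close> occurs
  at most to the first power.\<close>

lemma funpow_constashift:
  assumes "r \<in> carrier_vec n" "k \<le> n"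
  shows "(constashift l ^^ k) r = vec n (\<lambda>i. if i < k then l * r $ (n - k + i) else r $ (i - k))"
  using assms(2)
proof (induction k)
  case 0
  then show ?case using assms(1) by auto
next
  case (Suc k)
  then have IH: "(constashift l ^^ k) r
      = vec n (\<lambda>i. if i < k then l * r $ (n - k + i) else r $ (i - k))"
    by simp
  show ?case
    unfolding funpow.simps o_apply IH using Suc.prems
    by (intro eq_vecI) (auto simp: constashift_def Suc_diff_Suc)
qed

lemma funpow_constashift_length:
  assumes "r \<in> carrier_vec n"
  shows "(constashift l ^^ n) r = l \<cdot>\<^sub>v r"
  using assms by (subst funpow_constashift) auto

lemma constacyclic_imp_funpow:
  assumes "constacyclic n l C" "r \<in> C"
  shows "(constashift l ^^ k) r \<in> C"
  using assms by (induction k) (auto simp: constacyclic_def)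

text \<open>The n-fold shift multiplies by \<open>l\<close>, so it sends
  \<open>l \<cdot>\<^sub>v c\<close> to \<open>c\<close>; the (n-1)-fold shift of
  \<open>l \<cdot>\<^sub>v c\<close> is therefore a preimage.\<close>

lemma constacyclic_constashift_surj:
  fixes C :: "'a::comm_ring_1 vec set"
  assumes C: "linear_code n C" "constacyclic n l C" and l: "l * l = 1" and c: "c \<in> C"
  obtains d where "d \<in> C" "constashift l d = c"
proof (cases n)
  \<comment> \<open>There is no (n-1)-fold shift here, but on the empty vector the shift is the
    identity.\<close>
  case 0
  then have "constashift l c = c"
    using C(1) c by (intro eq_vecI) (auto simp: linear_code_def constashift_def)
  then show ?thesis using that c by blast
next
  case (Suc m)
  have lc: "l \<cdot>\<^sub>v c \<in> C" and cn: "c \<in> carrier_vec n"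
    using C(1) c by (auto simp: linear_code_def)
  have "constashift l ((constashift l ^^ m) (l \<cdot>\<^sub>v c)) = (constashift l ^^ n) (l \<cdot>\<^sub>v c)"
    using Suc by simp
  also have "\<dots> = c"
    using cn l by (simp add: funpow_constashift_length smult_smult_assoc)
  finally show ?thesis using that constacyclic_imp_funpow[OF C(2) lc] by blast
qed

text \<open>Every codeword \<open>c\<close> is the shift of a codeword \<open>d\<close>, and the
  isometry turns the product of the shift of \<open>x\<close> with \<open>c\<close> into
  \<open>x \<bullet> d = 0\<close>.\<close>

lemma constacyclic_dual:
  fixes C :: "'a::comm_ring_1 vec set"
  assumes C: "linear_code n C" "constacyclic n l C" and l: "l * l = 1"
  shows "constacyclic n l (dual_code n C)"
  unfolding constacyclic_def
proof (intro conjI ballI)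
  show "dual_code n C \<subseteq> carrier_vec n" by (auto simp: dual_code_def)
  fix x assume x: "x \<in> dual_code n C"
  have "constashift l x \<bullet> c = 0" if c: "c \<in> C" for c
  proof -
    obtain d where d: "d \<in> C" "constashift l d = c"
      using constacyclic_constashift_surj[OF C l c] .
    then show ?thesis
      using x C(1) scalar_prod_constashift[OF _ _ l, of x n d]
      by (auto simp: dual_code_def linear_code_def)
  qed
  then show "constashift l x \<in> dual_code n C"
    using x by (auto simp: dual_code_def)
qed

lemma linear_code_dual:
  fixes C :: "'a::comm_ring_1 vec set"
  assumes "C \<subseteq> carrier_vec n"
  shows "linear_code n (dual_code n C)"
  using assms unfolding linear_code_def dual_code_def
  by (auto simp: add_scalar_prod_distrib[of _ n] subset_iff)

lemma linear_code_subset_dual_dual: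
  fixes C :: "'a::comm_ring_1 vec set"
  assumes "C \<subseteq> carrier_vec n"
  shows "C \<subseteq> dual_code n (dual_code n C)"
proof
  fix c assume c: "c \<in> C"
  then have "c \<bullet> x = 0" if "x \<in> dual_code n C" for x
    using that assms comm_scalar_prod[of c n x] by (auto simp: dual_code_def)
  then show "c \<in> dual_code n (dual_code n C)"
    using c assms by (auto simp: dual_code_def)
qed


section \<open>The double dual over a field\<close>

lemma sum_fun_apply: "sum f A x = (\<Sum>i\<in>A. f i x)"
  by (induction A rule: infinite_finite_induct) auto

text \<open>A vector outside \<open>D\<close> is separated from \<open>D\<close> by a linear
  functional vanishing on \<open>D\<close>; the coefficient vector of that functional lies in the
  dual.\<close>

lemma dual_dual_field:
  fixes D :: "'a::field vec set"
  assumes D: "linear_code n D"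
  shows "dual_code n (dual_code n D) = D"
proof
  show "D \<subseteq> dual_code n (dual_code n D)"
    using D by (intro linear_code_subset_dual_dual) (simp add: linear_code_def)
  define sc where "sc = (\<lambda>(a::'a) (f::nat \<Rightarrow> 'a) i. a * f i)"
  interpret V: vector_space sc
    by unfold_locales (auto simp: sc_def fun_eq_iff algebra_simps)
  interpret F: vector_space "(*) :: 'a \<Rightarrow> 'a \<Rightarrow> 'a"
    by unfold_locales (auto simp: algebra_simps)
  interpret P: vector_space_pair sc "(*) :: 'a \<Rightarrow> 'a \<Rightarrow> 'a" ..
  \<comment> \<open>Padding with zeros embeds the vectors of length \<open>n\<close> in the space of
    all functions on the naturals, where the vector space structure is defined on the whole
    type.\<close>
  define \<phi> where "\<phi> = (\<lambda>(x::'a vec) i. if i < n then x $ i else 0)"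
  have \<phi>_inj: "x = y" if "x \<in> carrier_vec n" "y \<in> carrier_vec n" "\<phi> x = \<phi> y" for x y
    using that by (intro eq_vecI) (auto simp: \<phi>_def fun_eq_iff split: if_splits)
  have S: "V.subspace (\<phi> ` D)"
  proof (rule V.subspaceI)
    have "\<phi> (0\<^sub>v n) = 0" by (auto simp: \<phi>_def)
    then show "0 \<in> \<phi> ` D" using D unfolding linear_code_def by (metis image_eqI)
  next
    fix x y assume "x \<in> \<phi> ` D" "y \<in> \<phi> ` D"
    then obtain x' y' where xy: "x' \<in> D" "y' \<in> D" "x = \<phi> x'" "y = \<phi> y'" by blast
    then have "\<phi> (x' + y') = x + y"
      using D by (auto simp: \<phi>_def linear_code_def fun_eq_iff subset_iff)
    then show "x + y \<in> \<phi> ` D" using xy D unfolding linear_code_def by (metis image_eqI)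
  next
    fix c x assume "x \<in> \<phi> ` D"
    then obtain x' where x: "x' \<in> D" "x = \<phi> x'" by blast
    then have "\<phi> (c \<cdot>\<^sub>v x') = sc c x"
      using D by (auto simp: \<phi>_def linear_code_def sc_def fun_eq_iff subset_iff)
    then show "sc c x \<in> \<phi> ` D" using x D unfolding linear_code_def by (metis image_eqI)
  qed
  show "dual_code n (dual_code n D) \<subseteq> D"
  proof (rule subsetI, rule ccontr)
    fix v assume v: "v \<in> dual_code n (dual_code n D)" and "v \<notin> D"
    then have vn: "v \<in> carrier_vec n" by (simp add: dual_code_def)
    have vS: "\<phi> v \<notin> \<phi> ` D"
      using \<phi>_inj[OF vn] \<open>v \<notin> D\<close> D by (auto simp: linear_code_def)
    obtain B where B: "B \<subseteq> \<phi> ` D" "V.independent B" "\<phi> ` D \<subseteq> V.span B"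
      using V.maximal_independent_subset by blast
    have "V.span B \<subseteq> \<phi> ` D"
      using B(1) S by (rule V.span_minimal)
    then have "V.independent (insert (\<phi> v) B)"
      using B(2) vS by (intro V.independent_insertI) blast+
    \<comment> \<open>The functional is prescribed on an independent set: 1 at the image of
      \<open>v\<close>, 0 on the basis \<open>B\<close> of the image of \<open>D\<close>.\<close>
    from P.linear_independent_extend[OF this, of "\<lambda>x. if x = \<phi> v then 1 else 0"]
    obtain g where g: "Vector_Spaces.linear sc (*) g" and gv: "g (\<phi> v) = 1"
      and gB: "\<forall>x\<in>B. g x = (if x = \<phi> v then 1 else 0)"
      by auto
    interpret g: Vector_Spaces.linear sc "(*)" g by fact
    have "g x = 0" if "x \<in> B" for x
      using gB that B(1) vS by auto
    then have g0: "g (\<phi> d) = 0" if "d \<in> D" for d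
      using that B(3) g.eq_0_on_span[of B "\<phi> d"] by blast
    \<comment> \<open>The coefficients of \<open>g\<close> are its values at the unit
      vectors.\<close>
    define w where "w = vec n (\<lambda>i. g (\<lambda>j. if j = i then 1 else 0))"
    have gw: "w \<bullet> x = g (\<phi> x)" if "x \<in> carrier_vec n" for x
    proof -
      have "\<phi> x = (\<Sum>i<n. sc (x $ i) (\<lambda>j. if j = i then 1 else 0))"
        by (auto simp: fun_eq_iff \<phi>_def sc_def sum_fun_apply if_distrib cong: if_cong)
      then have "g (\<phi> x) = (\<Sum>i<n. x $ i * g (\<lambda>j. if j = i then 1 else 0))"
        by (simp add: g.sum g.scale)
      then show ?thesis
        using that by (simp add: w_def scalar_prod_def atLeast0LessThan mult.commute)
    qed
    have "w \<in> dual_code n D"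
      using gw g0 D by (auto simp: dual_code_def linear_code_def w_def subset_iff)
    then have "v \<bullet> w = 0" using v by (simp add: dual_code_def)
    moreover have "v \<bullet> w = w \<bullet> v"
      using vn by (intro comm_scalar_prod[of _ n]) (auto simp: w_def)
    ultimately show False using gw[OF vn] gv by simp
  qed
qed


section \<open>Evaluation homomorphisms of the ring\<close>

definition ru_eval :: "'a::comm_ring_1 \<Rightarrow> 'a ru \<Rightarrow> 'a" where
  "ru_eval a r = cf0 r + cf1 r * a + cf2 r * a ^ 2 + cf3 r * a ^ 3"

lemma ru_eval_add [simp]: "ru_eval a (r + s) = ru_eval a r + ru_eval a s"
  by (simp add: ru_eval_def plus_ru_def algebra_simps)

lemma ru_eval_0 [simp]: "ru_eval a 0 = 0"
  by (simp add: ru_eval_def zero_ru_def)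

lemma ru_eval_1 [simp]: "ru_eval a 1 = 1"
  by (simp add: ru_eval_def one_ru_def)

lemma ru_eval_const [simp]: "ru_eval a (const_ru c) = c"
  by (simp add: ru_eval_def const_ru_def)

lemma ru_eval_sum: "ru_eval a (sum f A) = (\<Sum>i\<in>A. ru_eval a (f i))"
  by (induction A rule: infinite_finite_induct) auto

lemma const_ru_0 [simp]: "const_ru 0 = 0"
  by (simp add: ru_arith)

lemma const_ru_add: "const_ru (a + b) = const_ru a + const_ru b"
  by (simp add: ru_arith)

lemma const_ru_sum: "const_ru (sum f A) = (\<Sum>i\<in>A. const_ru (f i))"
  by (induction A rule: infinite_finite_induct) (auto simp: const_ru_add)

text \<open>The reduction \<open>u^4 = u\<close> in the product is respected because
  \<open>a\<close> satisfies the same equation.\<close>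

lemma ru_eval_mult:
  assumes "a ^ 4 = a"
  shows "ru_eval a (r * s) = ru_eval a r * ru_eval a s"
proof -
  have a: "a * (a * (a * a)) = a" "a * (a * (a * (a * x))) = a * x" for x
    using assms by (metis power4_eq_xxxx mult.assoc)+
  show ?thesis
    by (simp add: a ru_eval_def times_ru_def power2_eq_square power3_eq_cube algebra_simps)
qed

lemma ru_eval_lambda: "ru_eval a (1 - 2 * u ^ 3) = 1 - 2 * a ^ 3"
proof -
  have "1 - 2 * u ^ 3 = (RU 1 0 0 (- 2) :: 'a ru)"
    unfolding mult_2 u_pow_3 by (simp add: ru_arith)
  then show ?thesis by (simp add: ru_eval_def)
qed

text \<open>Since \<open>u^6 = u^3\<close>, the element \<open>u^3\<close> is idempotent, and one
  minus twice an idempotent squares to 1.\<close>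

lemma lambda_square: "(1 - 2 * u ^ 3) * (1 - 2 * u ^ 3) = (1 :: 'a::comm_ring_1 ru)"
  unfolding mult_2 u_pow_3 by (simp add: ru_arith)

text \<open>A root \<open>a\<close> of \<open>X\<^sup>4 - X\<close> with its idempotent \<open>\<eta>\<close>: the ideal \<open>\<eta>R\<close> is a copy of
  the field on which \<open>R\<close> acts through evaluation at \<open>a\<close>.\<close>

locale ru_component =
  fixes a :: "'a::field" and \<eta> :: "'a ru"
  assumes root: "a ^ 4 = a"
    and eval_eta: "ru_eval a \<eta> = 1"
    and eta_mult: "\<eta> * r = \<eta> * const_ru (ru_eval a r)"
begin

lemma eval_mult [simp]: "ru_eval a (r * s) = ru_eval a r * ru_eval a s"
  by (rule ru_eval_mult[OF root])

lemma map_vec_eval_constashift: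
  "map_vec (ru_eval a) (constashift l r) = constashift (ru_eval a l) (map_vec (ru_eval a) r)"
  by (intro eq_vecI) (auto simp: constashift_def)

lemma constacyclic_eval_image:
  assumes "constacyclic n l C"
  shows "constacyclic n (ru_eval a l) (map_vec (ru_eval a) ` C)"
  using assms by (auto simp: constacyclic_def map_vec_eval_constashift[symmetric])

lemma linear_code_eval_image:
  assumes "linear_code n C"
  shows "linear_code n (map_vec (ru_eval a) ` C)"
  unfolding linear_code_def
proof (intro conjI ballI allI)
  show "map_vec (ru_eval a) ` C \<subseteq> carrier_vec n"
    using assms by (auto simp: linear_code_def)
  have "map_vec (ru_eval a) (0\<^sub>v n) = 0\<^sub>v n" by auto
  then show "0\<^sub>v n \<in> map_vec (ru_eval a) ` C"
    using assms unfolding linear_code_def by (metis image_eqI)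
next
  fix x y assume "x \<in> map_vec (ru_eval a) ` C" "y \<in> map_vec (ru_eval a) ` C"
  then obtain x' y' where xy: "x' \<in> C" "y' \<in> C"
    "x = map_vec (ru_eval a) x'" "y = map_vec (ru_eval a) y'" by blast
  moreover have "x' \<in> carrier_vec n" "y' \<in> carrier_vec n"
    using xy assms by (auto simp: linear_code_def)
  ultimately have "map_vec (ru_eval a) (x' + y') = x + y" by auto
  then show "x + y \<in> map_vec (ru_eval a) ` C"
    using xy assms unfolding linear_code_def by (metis image_eqI)
next
  fix c x assume "x \<in> map_vec (ru_eval a) ` C"
  then obtain x' where x: "x' \<in> C" "x = map_vec (ru_eval a) x'" by blast
  then have "map_vec (ru_eval a) (const_ru c \<cdot>\<^sub>v x') = c \<cdot>\<^sub>v x" by auto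
  then show "c \<cdot>\<^sub>v x \<in> map_vec (ru_eval a) ` C"
    using x assms unfolding linear_code_def by (metis image_eqI)
qed

text \<open>By \<open>eta_mult\<close>, multiplication by \<open>\<eta>\<close> sees only
  evaluations, so \<open>s\<close> can be replaced by a codeword with the same image.\<close>

lemma eta_smult_mem:
  assumes "linear_code n C" "map_vec (ru_eval a) s \<in> map_vec (ru_eval a) ` C"
  shows "\<eta> \<cdot>\<^sub>v s \<in> C"
proof -
  obtain c where c: "c \<in> C" "map_vec (ru_eval a) s = map_vec (ru_eval a) c"
    using assms(2) by blast
  have dim: "dim_vec s = dim_vec c"
    using c(2) by (metis index_map_vec(2))
  have ev: "ru_eval a (s $ i) = ru_eval a (c $ i)" if "i < dim_vec c" for i
    using that dim by (metis c(2) index_map_vec(1))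
  have "\<eta> \<cdot>\<^sub>v s = \<eta> \<cdot>\<^sub>v c"
    using dim by (intro eq_vecI) (auto, metis ev eta_mult)
  then show ?thesis using c(1) assms(1) by (simp add: linear_code_def)
qed

text \<open>A dual word \<open>w\<close> of the image code lifts to \<open>\<eta>\<close> times
  \<open>w\<close> in the dual of \<open>C\<close>. Evaluating its product with \<open>v\<close>
  shows that the image of \<open>v\<close> lies in the double dual over the field.\<close>

lemma dual_dual_eval_image:
  assumes C: "linear_code n C" and v: "v \<in> dual_code n (dual_code n C)"
  shows "map_vec (ru_eval a) v \<in> map_vec (ru_eval a) ` C"
proof -
  have vn: "v \<in> carrier_vec n" using v by (simp add: dual_code_def)
  have "map_vec (ru_eval a) v \<bullet> w = 0" if w: "w \<in> dual_code n (map_vec (ru_eval a) ` C)" for w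
  proof -
    have wn: "w \<in> carrier_vec n" using w by (simp add: dual_code_def)
    let ?w = "\<eta> \<cdot>\<^sub>v map_vec const_ru w"
    have summand: "\<eta> * const_ru b * r = \<eta> * const_ru (b * ru_eval a r)" for b r
      using eta_mult[of "const_ru b * r"] by (simp add: mult.assoc)
    have "?w \<bullet> c = 0" if c: "c \<in> C" for c
    proof -
      have cn: "c \<in> carrier_vec n" using c C by (auto simp: linear_code_def)
      have "?w \<bullet> c = (\<Sum>i<n. \<eta> * const_ru (w $ i * ru_eval a (c $ i)))"
        using cn wn
        by (auto simp: scalar_prod_def atLeast0LessThan summand intro!: sum.cong)
      also have "\<dots> = \<eta> * const_ru (w \<bullet> map_vec (ru_eval a) c)"
        using cn by (simp add: scalar_prod_def atLeast0LessThan const_ru_sum sum_distrib_left)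
      also have "\<dots> = 0" using w c by (simp add: dual_code_def)
      finally show ?thesis .
    qed
    then have "?w \<in> dual_code n C" using wn by (simp add: dual_code_def)
    then have "ru_eval a (v \<bullet> ?w) = 0" using v by (simp add: dual_code_def)
    moreover have "ru_eval a (v \<bullet> ?w) = map_vec (ru_eval a) v \<bullet> w"
      using vn wn by (simp add: scalar_prod_def ru_eval_sum eval_eta)
    ultimately show ?thesis by simp
  qed
  then have "map_vec (ru_eval a) v \<in> dual_code n (dual_code n (map_vec (ru_eval a) ` C))"
    using vn by (simp add: dual_code_def)
  then show ?thesis
    using dual_dual_field[OF linear_code_eval_image[OF C]] by simp
qed

end


section \<open>The four components\<close>

locale cube_root =
  fixes \<xi> :: "'a::field"
  assumes cube: "\<xi> ^ 3 = 1" and neq_1: "\<xi> \<noteq> 1"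
begin

lemma quad: "\<xi> ^ 2 + \<xi> + 1 = 0"
proof -
  have "(\<xi> - 1) * (\<xi> ^ 2 + \<xi> + 1) = 0"
    using cube by (simp add: power2_eq_square power3_eq_cube algebra_simps)
  then show ?thesis using neq_1 by simp
qed

text \<open>In characteristic 3 the equation \<open>\<xi>\<^sup>3 = 1\<close> reads \<open>(\<xi> - 1)\<^sup>3 = 0\<close>.\<close>

lemma three_neq_0: "(3::'a) \<noteq> 0"
proof
  assume "(3::'a) = 0"
  moreover have "(\<xi> - 1) ^ 3 = (\<xi> ^ 3 - 1) - 3 * (\<xi> ^ 2 - \<xi>)"
    by (simp add: power2_eq_square power3_eq_cube algebra_simps)
  ultimately have "(\<xi> - 1) ^ 3 = 0" using cube by simp
  then show False using neq_1 by simp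
qed

text \<open>A cancellation rule with \<open>inverse 3\<close> as an atom; to keep that form,
  \<open>inverse_eq_divide_numeral\<close> is switched off below.\<close>

lemma inv3: "3 * inverse 3 = (1::'a)"
  using three_neq_0 by simp

text \<open>These rules make every polynomial in \<open>\<xi>\<close> linear; the second one reaches
  into right-nested products.\<close>

lemma square: "\<xi> * \<xi> = - \<xi> - 1" "\<xi> * (\<xi> * x) = - \<xi> * x - x"
proof -
  show *: "\<xi> * \<xi> = - \<xi> - 1"
    using quad by (simp add: power2_eq_square eq_neg_iff_add_eq_0 algebra_simps)
  show "\<xi> * (\<xi> * x) = - \<xi> * x - x"
    unfolding mult.assoc[symmetric] * by (simp add: algebra_simps)
qed

lemmas xi_simps = square inv3 power2_eq_square power3_eq_cube power4_eq_xxxx algebra_simps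

lemma eta_RU:
  "eta1 = (RU 1 0 0 (- 1) :: 'a ru)"
  "eta2 = (RU 0 (inverse 3) (inverse 3) (inverse 3) :: 'a ru)"
  "eta3 \<xi> = RU 0 (inverse 3 * \<xi>) (inverse 3 * \<xi> ^ 2) (inverse 3)"
  "eta4 \<xi> = RU 0 (inverse 3 * \<xi> ^ 2) (inverse 3 * \<xi>) (inverse 3)"
  unfolding eta1_def eta2_def eta3_def eta4_def u_pow_2 u_pow_3 by (simp_all add: ru_arith)

sublocale c1: ru_component 0 "eta1 :: 'a ru"
  by unfold_locales (simp_all add: eta_RU ru_eval_def times_ru_def const_ru_def)

sublocale c2: ru_component 1 "eta2 :: 'a ru"
  by unfold_locales
    (simp_all add: eta_RU ru_eval_def times_ru_def const_ru_def xi_simps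
      del: inverse_eq_divide_numeral)

text \<open>The root for \<open>eta3\<close> is \<open>\<xi> ^ 2\<close>: there each of its three
  terms becomes 1/3, whereas at \<open>\<xi>\<close> they add up to a multiple of
  \<open>\<xi> ^ 2 + \<xi> + 1 = 0\<close>.\<close>

sublocale c3: ru_component "\<xi> ^ 2" "eta3 \<xi>"
  by unfold_locales
    (simp_all add: eta_RU ru_eval_def times_ru_def const_ru_def xi_simps
      del: inverse_eq_divide_numeral)

sublocale c4: ru_component \<xi> "eta4 \<xi>"
  by unfold_locales
    (simp_all add: eta_RU ru_eval_def times_ru_def const_ru_def xi_simps
      del: inverse_eq_divide_numeral)

lemma eta_sum: "eta1 + eta2 + eta3 \<xi> + eta4 \<xi> = 1"
  by (simp add: eta_RU plus_ru_def one_ru_def xi_simps del: inverse_eq_divide_numeral)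

lemma eval_eta_distinct:
  "ru_eval 0 (eta2 :: 'a ru) = 0" "ru_eval 0 (eta3 \<xi>) = 0" "ru_eval 0 (eta4 \<xi>) = 0"
  "ru_eval 1 (eta1 :: 'a ru) = 0" "ru_eval 1 (eta3 \<xi>) = 0" "ru_eval 1 (eta4 \<xi>) = 0"
  "ru_eval (\<xi> ^ 2) eta1 = 0" "ru_eval (\<xi> ^ 2) eta2 = 0" "ru_eval (\<xi> ^ 2) (eta4 \<xi>) = 0"
  "ru_eval \<xi> eta1 = 0" "ru_eval \<xi> eta2 = 0" "ru_eval \<xi> (eta3 \<xi>) = 0"
  by (simp_all add: eta_RU ru_eval_def xi_simps del: inverse_eq_divide_numeral)

lemma eval_eta_comb:
  assumes "x \<in> carrier_vec n" "y \<in> carrier_vec n" "z \<in> carrier_vec n" "t \<in> carrier_vec n"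
  shows "map_vec (ru_eval 0) (eta_comb \<xi> x y z t) = x"
    and "map_vec (ru_eval 1) (eta_comb \<xi> x y z t) = y"
    and "map_vec (ru_eval (\<xi> ^ 2)) (eta_comb \<xi> x y z t) = z"
    and "map_vec (ru_eval \<xi>) (eta_comb \<xi> x y z t) = t"
  using assms
  by (auto simp: eta_comb_def eval_eta_distinct c1.eval_eta c2.eval_eta c3.eval_eta c4.eval_eta
      intro!: eq_vecI)

lemma eta_decomp:
  assumes "s \<in> carrier_vec n"
  shows "eta1 \<cdot>\<^sub>v s + eta2 \<cdot>\<^sub>v s + eta3 \<xi> \<cdot>\<^sub>v s + eta4 \<xi> \<cdot>\<^sub>v s = s"
  using assms by (intro eq_vecI) (auto simp: distrib_right[symmetric] eta_sum[unfolded add.assoc])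

lemma eta_comb_eval:
  assumes "s \<in> carrier_vec n"
  shows "eta_comb \<xi> (map_vec (ru_eval 0) s) (map_vec (ru_eval 1) s)
    (map_vec (ru_eval (\<xi> ^ 2)) s) (map_vec (ru_eval \<xi>) s) = s" (is "?c = s")
proof -
  have "?c = eta1 \<cdot>\<^sub>v s + eta2 \<cdot>\<^sub>v s + eta3 \<xi> \<cdot>\<^sub>v s + eta4 \<xi> \<cdot>\<^sub>v s"
    unfolding eta_comb_def using assms
    by (intro eq_vecI) (auto simp: c1.eta_mult[symmetric] c2.eta_mult[symmetric]
        c3.eta_mult[symmetric] c4.eta_mult[symmetric])
  then show ?thesis using eta_decomp[OF assms] by simp
qed

text \<open>Evaluation reads off the components of an \<open>eta_comb\<close>, and every codeword is
  the \<open>eta_comb\<close> of its own evaluations.\<close>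

lemma comp_eq_image:
  fixes C :: "'a ru vec set"
  assumes "linear_code n C"
  shows "comp1 n \<xi> C = map_vec (ru_eval 0) ` C"
    and "comp2 n \<xi> C = map_vec (ru_eval 1) ` C"
    and "comp3 n \<xi> C = map_vec (ru_eval (\<xi> ^ 2)) ` C"
    and "comp4 n \<xi> C = map_vec (ru_eval \<xi>) ` C"
proof -
  have C: "c \<in> carrier_vec n" if "c \<in> C" for c
    using that assms by (auto simp: linear_code_def)
  have mem: "eta_comb \<xi> (map_vec (ru_eval 0) c) (map_vec (ru_eval 1) c)
      (map_vec (ru_eval (\<xi> ^ 2)) c) (map_vec (ru_eval \<xi>) c) \<in> C" if "c \<in> C" for c
    using that by (simp add: eta_comb_eval[OF C])
  have img: "x \<in> map_vec (ru_eval 0) ` C" "y \<in> map_vec (ru_eval 1) ` C"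
      "z \<in> map_vec (ru_eval (\<xi> ^ 2)) ` C" "t \<in> map_vec (ru_eval \<xi>) ` C"
    if "x \<in> carrier_vec n" "y \<in> carrier_vec n" "z \<in> carrier_vec n" "t \<in> carrier_vec n"
      "eta_comb \<xi> x y z t \<in> C" for x y z t
    using eval_eta_comb[OF that(1-4)] imageI[OF that(5)] by metis+
  have car: "map_vec f c \<in> carrier_vec n" if "c \<in> C" for f :: "'a ru \<Rightarrow> 'a" and c
    using C[OF that] by simp
  show "comp1 n \<xi> C = map_vec (ru_eval 0) ` C"
    unfolding comp1_def
    by (rule subset_antisym; rule subsetI) (use img(1) in blast, use mem car in blast)
  show "comp2 n \<xi> C = map_vec (ru_eval 1) ` C"
    unfolding comp2_def
    by (rule subset_antisym; rule subsetI) (use img(2) in blast, use mem car in blast)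
  show "comp3 n \<xi> C = map_vec (ru_eval (\<xi> ^ 2)) ` C"
    unfolding comp3_def
    by (rule subset_antisym; rule subsetI) (use img(3) in blast, use mem car in blast)
  show "comp4 n \<xi> C = map_vec (ru_eval \<xi>) ` C"
    unfolding comp4_def
    by (rule subset_antisym; rule subsetI) (use img(4) in blast, use mem car in blast)
qed

text \<open>The four images may come from four different codewords: each multiple of
  \<open>s\<close> by an idempotent lies in \<open>C\<close> separately, and these multiples sum to
  \<open>s\<close>.\<close>

lemma mem_code_if_components:
  fixes C :: "'a ru vec set"
  assumes C: "linear_code n C" and s: "s \<in> carrier_vec n"
    and "map_vec (ru_eval 0) s \<in> map_vec (ru_eval 0) ` C"
    and "map_vec (ru_eval 1) s \<in> map_vec (ru_eval 1) ` C"
    and "map_vec (ru_eval (\<xi> ^ 2)) s \<in> map_vec (ru_eval (\<xi> ^ 2)) ` C"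
    and "map_vec (ru_eval \<xi>) s \<in> map_vec (ru_eval \<xi>) ` C"
  shows "s \<in> C"
proof -
  have "eta1 \<cdot>\<^sub>v s + eta2 \<cdot>\<^sub>v s + eta3 \<xi> \<cdot>\<^sub>v s + eta4 \<xi> \<cdot>\<^sub>v s \<in> C"
    using c1.eta_smult_mem[OF C] c2.eta_smult_mem[OF C] c3.eta_smult_mem[OF C]
      c4.eta_smult_mem[OF C] assms
    by (simp add: linear_code_def)
  then show ?thesis using eta_decomp[OF s] by simp
qed

lemma dual_dual_code:
  fixes C :: "'a ru vec set"
  assumes C: "linear_code n C"
  shows "dual_code n (dual_code n C) = C"
proof
  show "C \<subseteq> dual_code n (dual_code n C)"
    using C by (intro linear_code_subset_dual_dual) (simp add: linear_code_def)
  show "dual_code n (dual_code n C) \<subseteq> C"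
  proof
    fix v assume v: "v \<in> dual_code n (dual_code n C)"
    then have "v \<in> carrier_vec n" by (simp add: dual_code_def)
    then show "v \<in> C"
      using c1.dual_dual_eval_image[OF C v] c2.dual_dual_eval_image[OF C v]
        c3.dual_dual_eval_image[OF C v] c4.dual_dual_eval_image[OF C v]
      by (rule mem_code_if_components[OF C])
  qed
qed

text \<open>The nonzero roots all have cube 1.\<close>

lemma eval_lambda:
  "ru_eval 0 (1 - 2 * u ^ 3) = (1 :: 'a)" "ru_eval 1 (1 - 2 * u ^ 3) = (- 1 :: 'a)"
  "ru_eval (\<xi> ^ 2) (1 - 2 * u ^ 3) = - 1" "ru_eval \<xi> (1 - 2 * u ^ 3) = - 1"
  unfolding ru_eval_lambda by (simp_all add: xi_simps)

lemma constacyclic_iff_components: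
  fixes C :: "'a ru vec set"
  assumes C: "linear_code n C"
  shows "constacyclic n (1 - 2 * u ^ 3) C \<longleftrightarrow>
    cyclic n (comp1 n \<xi> C) \<and> negacyclic n (comp2 n \<xi> C) \<and>
    negacyclic n (comp3 n \<xi> C) \<and> negacyclic n (comp4 n \<xi> C)" (is "?L \<longleftrightarrow> ?R")
proof
  assume ?L
  then show ?R
    unfolding comp_eq_image[OF C]
    using c1.constacyclic_eval_image c2.constacyclic_eval_image
      c3.constacyclic_eval_image c4.constacyclic_eval_image
    by (metis eval_lambda)
next
  assume R: ?R
  show ?L unfolding constacyclic_def
  proof (intro conjI ballI)
    show Cn: "C \<subseteq> carrier_vec n" using C by (simp add: linear_code_def)
    fix r assume r: "r \<in> C"
    \<comment> \<open>Each evaluation of the shifted word is the cyclic or negacyclic shift of a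
      component of \<open>r\<close>.\<close>
    then show "constashift (1 - 2 * u ^ 3) r \<in> C"
      using R Cn unfolding comp_eq_image[OF C]
      by (intro mem_code_if_components[OF C])
        (auto simp: c1.map_vec_eval_constashift c2.map_vec_eval_constashift
          c3.map_vec_eval_constashift c4.map_vec_eval_constashift eval_lambda constacyclic_def)
  qed
qed

lemma constacyclic_iff_dual:
  fixes C :: "'a ru vec set"
  assumes C: "linear_code n C"
  shows "constacyclic n (1 - 2 * u ^ 3) C \<longleftrightarrow> constacyclic n (1 - 2 * u ^ 3) (dual_code n C)"
proof
  assume "constacyclic n (1 - 2 * u ^ 3) (dual_code n C)"
  moreover have "linear_code n (dual_code n C)"
    using C by (intro linear_code_dual) (simp add: linear_code_def)
  ultimately show "constacyclic n (1 - 2 * u ^ 3) C"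
    \<comment> \<open>The forward direction is applied to the dual code, whose dual is
      \<open>C\<close> again.\<close>
    using constacyclic_dual[OF _ _ lambda_square] dual_dual_code[OF C] by metis
qed (rule constacyclic_dual[OF C _ lambda_square])

end

theorem theorem2:
  fixes p n :: nat
    and \<xi> :: "'p::prime_card mod_ring"
    and C :: "'p mod_ring ru vec set"
  assumes "p = CARD('p)"
    and "[p = 1] (mod 3)"
    and "\<xi> ^ 3 = 1" and "\<xi> \<noteq> 1"
    and "linear_code n C"
  shows "(constacyclic n (1 - 2 * u ^ 3) C \<longleftrightarrow>
            cyclic n (comp1 n \<xi> C) \<and> negacyclic n (comp2 n \<xi> C) \<and>
            negacyclic n (comp3 n \<xi> C) \<and> negacyclic n (comp4 n \<xi> C)) \<and>
         (constacyclic n (1 - 2 * u ^ 3) C \<longleftrightarrow>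
            constacyclic n (1 - 2 * u ^ 3) (dual_code n C))"
proof -
  interpret cube_root \<xi> by unfold_locales fact+
  show ?thesis
    using constacyclic_iff_components constacyclic_iff_dual \<open>linear_code n C\<close> by blast
qed

end
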